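(* Let $G$ be an $(n,d,\lambda)$-graph and $U$ a subset of vertices with $\lambda n/d=o(|U|)$. Then there is a subset $U'\subset U$ with $|U'|=(1-o(1))|U|$ such that \[\left|H_1(U')-\frac{|U'|^5d^5}{n^5}\right|\ll \lambda^2\frac{|U'|^3d^2}{n^2}+\lambda\frac{|U'|^4d^4}{n^4}.\]
   Context: An $(n,d,\lambda)$-graph is a $d$-regular graph on $n$ vertices all of whose adjacency eigenvalues other than the largest have absolute value at most $\lambda$; $u\sim v$ denotes adjacency. For $W\subset V(G)$, $H_1(W)$ is the number of $5$-tuples $(x,y,z,u,v)\in W^5$ (not necessarily distinct) with $x\sim y$, $y\sim z$, $z\sim u$, $u\sim v$, $u\sim x$. Asymptotic notation refers to $n\to\infty$; $f\ll g$ means $f=O(g)$. *)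

theory Defs
  imports
    Complex_Main
    "HOL-Library.Landau_Symbols"
    "Jordan_Normal_Form.Char_Poly"
    "Graph_Theory.Pair_Digraph"
begin

text \<open>
  Finite simple undirected graphs are rendered by the locale predicate \<^const>\<open>pair_graph\<close>: the
  vertex set is finite and the arc relation \<^const>\<open>parcs\<close> is a symmetric irreflexive relation on it,
  so that \<open>u \<sim> v\<close> is \<open>(u, v) \<in> parcs G\<close> and the degree of a vertex is its out-degree.
\<close>

definition adj_matrix :: "'a pair_pre_digraph \<Rightarrow> 'a list \<Rightarrow> real mat" where
  "adj_matrix G vs =
     mat (length vs) (length vs) (\<lambda>(i, j). if (vs ! i, vs ! j) \<in> parcs G then 1 else 0)"

text \<open>
  Eigenvalues are taken with multiplicity. The matrix is real symmetric, hence all roots of its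
  characteristic polynomial are real; another enumeration of the vertices conjugates the matrix by
  a permutation matrix, hence the choice does not affect the result.
\<close>

definition adj_eigenvalues :: "'a pair_pre_digraph \<Rightarrow> real multiset" where
  "adj_eigenvalues G =
     proots (char_poly (adj_matrix G (SOME vs. distinct vs \<and> set vs = pverts G)))"

text \<open>
  Only one copy of the largest eigenvalue is discarded: if it is repeated, its other copies still
  have to be bounded by \<open>\<lambda>\<close>.
\<close>

definition ndl_graph :: "nat \<Rightarrow> nat \<Rightarrow> real \<Rightarrow> 'a pair_pre_digraph \<Rightarrow> bool" where
  "ndl_graph n d lam G \<longleftrightarrow>
     pair_graph G \<and>
     card (pverts G) = n \<and>
     (\<forall>v \<in> pverts G. out_degree (with_proj G) v = d) \<and>
     (\<forall>\<mu> \<in># adj_eigenvalues G - {# Max_mset (adj_eigenvalues G) #}. \<bar>\<mu>\<bar> \<le> lam)"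

definition H1 :: "'a pair_pre_digraph \<Rightarrow> 'a set \<Rightarrow> nat" where
  "H1 G W = card {(x, y, z, u, v).
     x \<in> W \<and> y \<in> W \<and> z \<in> W \<and> u \<in> W \<and> v \<in> W \<and>
     (x, y) \<in> parcs G \<and> (y, z) \<in> parcs G \<and> (z, u) \<in> parcs G \<and>
     (u, v) \<in> parcs G \<and> (u, x) \<in> parcs G}"

end

theory Submission
  imports Defs "Jordan_Normal_Form.Schur_Decomposition" "HOL-Analysis.Convex"
begin

text \<open>
  Write \<open>\<delta> = d/n\<close>, \<open>m = |W|\<close>, \<open>N(u)\<close> for the neighbourhood of \<open>u\<close> in \<open>W\<close> and \<open>b(u) = |N(u)|\<close>. The
  spectral gap enters only through the discrepancy bound
  \<open>\<Sum>z. (|N(z) \<inter> S| - \<delta> |S|)^2 \<le> \<lambda>^2 |S|\<close>. It says that \<open>A\<close> has norm at most \<open>\<lambda>\<close> on the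
  orthogonal complement of the all-ones vector, which follows from the trace method: on such \<open>x\<close> one has
  \<open>|A^k x|^2 \<le> (tr A^(2k) - d^(2k)) |x|^2 \<le> n \<lambda>^(2k) |x|^2\<close>, and \<open>k \<mapsto> |A^k x|^2\<close> is log-convex.

  Deleting from \<open>U\<close> the vertices with more than \<open>3/2 \<delta> |U|\<close> neighbours in \<open>U\<close> removes \<open>o(|U|)\<close>
  vertices, by the discrepancy bound for \<open>S = U\<close>, and ensures \<open>b \<le> 2 \<delta> m\<close> on the remaining set \<open>W\<close>.
  Then \<open>H\<^sub>1(W) = \<Sum>u. b(u) (\<Sum>y. |N(u) \<inter> N(y)|^2)\<close>. Expanding the codegree around \<open>\<delta> b(u)\<close> leaves
  three terms: the square of the deviation, at most \<open>\<lambda>^2 b(u)\<close> by the discrepancy bound for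
  \<open>S = N(u)\<close>; the cross term and \<open>\<delta>^2 m (\<Sum>u. b(u)^3) - \<delta>^5 m^5\<close>, both controlled by
  \<open>\<Sum>u. |b(u) - \<delta> m| \<le> \<lambda> m\<close>.
\<close>

section \<open>Symmetric matrices with constant row sums\<close>

text \<open>The Hermitian form of \<open>A\<close> at an eigenvector is its own conjugate by
  symmetry, and it equals \<open>a\<close> times the positive real number \<open>N\<close>.\<close>

lemma symmetric_eigenvalue_real:
  fixes A :: "real mat" and a :: complex
  assumes A: "A \<in> carrier_mat n n"
    and sym: "\<And>i j. i < n \<Longrightarrow> j < n \<Longrightarrow> A $$ (i, j) = A $$ (j, i)"
    and ev: "eigenvalue (map_mat complex_of_real A) a"
  shows "a \<in> \<real>"
proof -
  let ?A = "map_mat complex_of_real A"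
  obtain v where v: "v \<in> carrier_vec n" "v \<noteq> 0\<^sub>v n" "?A *\<^sub>v v = a \<cdot>\<^sub>v v"
    using ev A unfolding eigenvalue_def eigenvector_def by auto
  have row: "(\<Sum>j<n. of_real (A $$ (i, j)) * v $ j) = a * v $ i" if "i < n" for i
  proof -
    have "(?A *\<^sub>v v) $ i = (\<Sum>j<n. of_real (A $$ (i, j)) * v $ j)"
      using that A v(1) by (auto simp: scalar_prod_def lessThan_atLeast0 intro!: sum.cong)
    then show ?thesis using v that by simp
  qed
  define S where "S = (\<Sum>i<n. cnj (v $ i) * (a * v $ i))"
  define N where "N = (\<Sum>i<n. (cmod (v $ i))\<^sup>2)"
  have S: "S = (\<Sum>i<n. \<Sum>j<n. cnj (v $ i) * of_real (A $$ (i, j)) * v $ j)"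
    unfolding S_def by (simp add: row[symmetric] sum_distrib_left mult.assoc)
  have "cnj S = (\<Sum>i<n. \<Sum>j<n. cnj (v $ j) * of_real (A $$ (i, j)) * v $ i)"
    unfolding S by (simp add: mult_ac)
  also have "\<dots> = (\<Sum>j<n. \<Sum>i<n. cnj (v $ j) * of_real (A $$ (i, j)) * v $ i)"
    by (rule sum.swap)
  also have "\<dots> = S" unfolding S by (intro sum.cong refl) (simp add: sym)
  finally have "cnj S = S" .
  moreover have SN: "S = a * of_real N"
    unfolding S_def N_def by (simp add: sum_distrib_left complex_norm_square mult_ac del: of_real_power)
  moreover have "N > 0"
  proof -
    obtain i where i: "i < n" "v $ i \<noteq> 0" using v by (metis carrier_vecD eq_vecI index_zero_vec(1,2))
    then show ?thesis unfolding N_def by (intro sum_pos2[where i = i]) auto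
  qed
  ultimately have "cnj a = a" by auto
  then show ?thesis by (simp add: Reals_cnj_iff)
qed

text \<open>Over the complex numbers the polynomial splits with real roots; the corresponding real
  product has the same image under the embedding of polynomials, which is injective.\<close>

lemma symmetric_char_poly_splits:
  fixes A :: "real mat"
  assumes A: "A \<in> carrier_mat n n"
    and sym: "\<And>i j. i < n \<Longrightarrow> j < n \<Longrightarrow> A $$ (i, j) = A $$ (j, i)"
  shows "\<exists>es. char_poly A = (\<Prod>e\<leftarrow>es. [:- e, 1:]) \<and> length es = n"
proof -
  interpret poly_hom: map_poly_inj_idom_hom complex_of_real ..
  let ?A = "map_mat complex_of_real A"
  have cA: "?A \<in> carrier_mat n n" using A by simp
  obtain as where as: "char_poly ?A = (\<Prod>a\<leftarrow>as. [:- a, 1:])" "length as = n"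
    using char_poly_factorized[OF cA] by blast
  have "a \<in> \<real>" if "a \<in> set as" for a
  proof -
    have "poly (char_poly ?A) a = 0" unfolding as by (rule linear_poly_root[OF that])
    then show ?thesis
      using symmetric_eigenvalue_real[OF A sym] eigenvalue_root_char_poly[OF cA] by blast
  qed
  then have "(\<Prod>a\<leftarrow>as. [:- a, 1:]) = map_poly of_real (\<Prod>e\<leftarrow>map Re as. [:- e, 1:])"
  proof (induction as)
    case (Cons a as)
    then have "[:- a, 1:] = map_poly complex_of_real [:- Re a, 1:]" by simp
    then show ?case using Cons by (simp only: list.map prod_list.Cons poly_hom.hom_mult) auto
  qed simp
  moreover have "char_poly ?A = map_poly of_real (char_poly A)"
    by (rule of_real_hom.char_poly_hom[OF A])
  ultimately have "char_poly A = (\<Prod>e\<leftarrow>map Re as. [:- e, 1:])"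
    using as by (metis poly_hom.injectivity)
  then show ?thesis using as by (metis length_map)
qed

section \<open>Traces of matrix powers\<close>

definition mat_trace :: "'a :: comm_monoid_add mat \<Rightarrow> 'a" where
  "mat_trace A = (\<Sum>i<dim_row A. A $$ (i, i))"

lemma mat_mult_index_sum:
  assumes "A \<in> carrier_mat n m" "B \<in> carrier_mat m k" "i < n" "j < k"
  shows "(A * B) $$ (i, j) = (\<Sum>l<m. A $$ (i, l) * B $$ (l, j))"
  using assms by (auto simp: scalar_prod_def lessThan_atLeast0)

lemma mat_trace_mult_commute:
  fixes A B :: "'a :: comm_semiring_0 mat"
  assumes "A \<in> carrier_mat n m" "B \<in> carrier_mat m n"
  shows "mat_trace (A * B) = mat_trace (B * A)"
proof -
  have "mat_trace (A * B) = (\<Sum>i<n. \<Sum>l<m. A $$ (i, l) * B $$ (l, i))"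
    using assms by (auto simp: mat_trace_def mat_mult_index_sum[OF assms] simp del: index_mult_mat(1) intro!: sum.cong)
  also have "\<dots> = (\<Sum>l<m. \<Sum>i<n. A $$ (i, l) * B $$ (l, i))" by (rule sum.swap)
  also have "\<dots> = mat_trace (B * A)"
    using assms by (auto simp: mat_trace_def mat_mult_index_sum[OF assms(2,1)] mult.commute simp del: index_mult_mat(1) intro!: sum.cong)
  finally show ?thesis .
qed

lemma upper_triangular_pow:
  fixes B :: "'a :: comm_semiring_1 mat"
  assumes B: "B \<in> carrier_mat n n" and ut: "upper_triangular B"
  shows "upper_triangular (B ^\<^sub>m k) \<and> (\<forall>i<n. (B ^\<^sub>m k) $$ (i, i) = B $$ (i, i) ^ k)"
proof (induction k)
  case 0
  then show ?case using B by auto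
next
  case (Suc k)
  have Bk: "B ^\<^sub>m k \<in> carrier_mat n n" using B by simp
  \<comment> \<open>Either \<open>l < i\<close> and the first factor lies below the diagonal, or
    \<open>j < l\<close> and the second one does; on and below the diagonal only
    \<open>l = i = j\<close> escapes.\<close>
  have zero: "(B ^\<^sub>m k) $$ (i, l) * B $$ (l, j) = 0" if "i < n" "l < n" "j \<le> i" "l \<noteq> i \<or> j < i" for i j l
  proof (cases "l < i")
    case True
    then show ?thesis using Suc Bk that by (metis carrier_matD(1) mult_zero_left upper_triangularD)
  next
    case False
    then have "j < l" using that by auto
    then show ?thesis using ut B that by (metis carrier_matD(1) mult_zero_right upper_triangularD)
  qed
  have "upper_triangular (B ^\<^sub>m Suc k)"
    using B by (intro upper_triangularI) (simp add: mat_mult_index_sum[OF Bk B] zero del: index_mult_mat(1))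
  moreover have "(B ^\<^sub>m Suc k) $$ (i, i) = B $$ (i, i) ^ Suc k" if i: "i < n" for i
  proof -
    have "(B ^\<^sub>m Suc k) $$ (i, i) = (\<Sum>l<n. (B ^\<^sub>m k) $$ (i, l) * B $$ (l, i))"
      using mat_mult_index_sum[OF Bk B i i] by simp
    also have "\<dots> = (\<Sum>l\<in>{i}. (B ^\<^sub>m k) $$ (i, l) * B $$ (l, i))"
      using i by (intro sum.mono_neutral_right) (auto simp: zero)
    finally show ?thesis using Suc i by (simp add: mult.commute)
  qed
  ultimately show ?case by blast
qed

text \<open>Schur decomposition makes \<open>A\<close> similar to a triangular \<open>B\<close> with
  diagonal \<open>es\<close>; cyclicity of the trace removes the conjugating matrices.\<close>

lemma mat_trace_pow:
  fixes A :: "'a :: conjugatable_ordered_field mat"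
  assumes A: "A \<in> carrier_mat n n" and es: "char_poly A = (\<Prod>e\<leftarrow>es. [:- e, 1:])"
  shows "mat_trace (A ^\<^sub>m k) = (\<Sum>e\<leftarrow>es. e ^ k)"
proof -
  obtain B P Q where "schur_decomposition A es = (B, P, Q)" by (metis prod_cases3)
  from schur_decomposition[OF A es this]
  have wit: "similar_mat_wit A B P Q" and ut: "upper_triangular B" and diag: "diag_mat B = es"
    by auto
  note D = similar_mat_witD2[OF A wit]
  have Bk: "B ^\<^sub>m k \<in> carrier_mat n n" using D by simp
  have "mat_trace (A ^\<^sub>m k) = mat_trace (P * (B ^\<^sub>m k * Q))"
    using similar_mat_wit_pow_id[OF wit, of k] D Bk by (metis assoc_mult_mat)
  also have "\<dots> = mat_trace (B ^\<^sub>m k * Q * P)"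
    using D Bk by (intro mat_trace_mult_commute[of _ n n]) auto
  also have "B ^\<^sub>m k * Q * P = B ^\<^sub>m k" using D Bk by (metis assoc_mult_mat right_mult_one_mat)
  also have "mat_trace (B ^\<^sub>m k) = (\<Sum>i<n. B $$ (i, i) ^ k)"
    using upper_triangular_pow[OF D(5) ut, of k] D(5) by (simp add: mat_trace_def)
  also have "\<dots> = (\<Sum>e\<leftarrow>es. e ^ k)"
    unfolding diag[symmetric] using D(5)
    by (simp add: diag_mat_def comp_def interv_sum_list_conv_sum_set_nat lessThan_atLeast0)
  finally show ?thesis .
qed

section \<open>Powers of symmetric matrices with constant row sums\<close>

lemma pow_mat_add:
  assumes A: "A \<in> carrier_mat n n"
  shows "A ^\<^sub>m (k + l) = A ^\<^sub>m k * A ^\<^sub>m l"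
proof (induction l)
  case 0
  show ?case using A by (simp add: right_mult_one_mat[of _ n n])
next
  case (Suc l)
  have "A ^\<^sub>m k \<in> carrier_mat n n" "A ^\<^sub>m l \<in> carrier_mat n n" using A by auto
  then show ?case using Suc A by (simp add: assoc_mult_mat[of _ n n _ n _ n])
qed

lemma symmetric_pow_mat:
  fixes A :: "'a :: comm_semiring_1 mat"
  assumes A: "A \<in> carrier_mat n n" and sym: "transpose_mat A = A"
  shows "transpose_mat (A ^\<^sub>m k) = A ^\<^sub>m k"
proof (induction k)
  case 0
  show ?case using A by simp
next
  case (Suc k)
  have "transpose_mat (A ^\<^sub>m Suc k) = A * A ^\<^sub>m k"
    using A Suc sym by (simp add: transpose_mult[of _ n n _ n])
  also have "\<dots> = A ^\<^sub>m (1 + k)" using pow_mat_add[OF A, of 1 k] A by simp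
  finally show ?case by simp
qed

lemma symmetric_mat_index:
  assumes "A \<in> carrier_mat n n" "transpose_mat A = A" "i < n" "j < n"
  shows "A $$ (i, j) = A $$ (j, i)"
  using assms by (metis carrier_matD index_transpose_mat(1))

lemma row_sum_pow_mat:
  fixes A :: "'a :: comm_semiring_1 mat"
  assumes A: "A \<in> carrier_mat n n" and d: "\<And>i. i < n \<Longrightarrow> (\<Sum>j<n. A $$ (i, j)) = d"
    and i: "i < n"
  shows "(\<Sum>j<n. (A ^\<^sub>m k) $$ (i, j)) = d ^ k"
proof (induction k)
  case 0
  show ?case using A i by simp
next
  case (Suc k)
  have Ak: "A ^\<^sub>m k \<in> carrier_mat n n" using A by simp
  have "(\<Sum>j<n. (A ^\<^sub>m Suc k) $$ (i, j)) = (\<Sum>j<n. \<Sum>l<n. (A ^\<^sub>m k) $$ (i, l) * A $$ (l, j))"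
    using mat_mult_index_sum[OF Ak A i] by simp
  also have "\<dots> = (\<Sum>l<n. (A ^\<^sub>m k) $$ (i, l) * (\<Sum>j<n. A $$ (l, j)))"
    by (subst sum.swap) (simp add: sum_distrib_left)
  also have "\<dots> = (\<Sum>l<n. (A ^\<^sub>m k) $$ (i, l)) * d"
    by (simp add: d sum_distrib_right)
  finally show ?case using Suc by (simp add: mult.commute)
qed

text \<open>The factor with \<open>es\<close> is the squared Frobenius norm of \<open>A^k - (d^k / n) J\<close>, which acts as
  \<open>A^k\<close> on vectors orthogonal to the all-ones vector.\<close>

lemma symmetric_pow_deflated_bound:
  fixes A :: "real mat" and x :: "nat \<Rightarrow> real"
  assumes A: "A \<in> carrier_mat n n" and sym: "transpose_mat A = A"
    and d: "\<And>i. i < n \<Longrightarrow> (\<Sum>j<n. A $$ (i, j)) = d"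
    and es: "char_poly A = (\<Prod>e\<leftarrow>es. [:- e, 1:])"
    and x: "(\<Sum>j<n. x j) = 0"
  shows "(\<Sum>i<n. (\<Sum>j<n. (A ^\<^sub>m k) $$ (i, j) * x j)\<^sup>2)
    \<le> ((\<Sum>e\<leftarrow>es. e ^ (k + k)) - d ^ (k + k)) * (\<Sum>j<n. (x j)\<^sup>2)"
proof (cases "n = 0")
  case True
  then show ?thesis by simp
next
  case False
  \<comment> \<open>The mean entry of every row of \<open>A ^\<^sub>m k\<close>; subtracting it
    lowers the sum of squares of each row by \<open>d ^ (k + k) / n\<close>.\<close>
  define c where "c = d ^ k / n"
  define a where "a i j = (A ^\<^sub>m k) $$ (i, j)" for i j
  have Ak: "A ^\<^sub>m k \<in> carrier_mat n n" using A by simp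
  have row: "(\<Sum>j<n. a i j) = d ^ k" if "i < n" for i
    unfolding a_def by (rule row_sum_pow_mat[OF A d that])
  \<comment> \<open>By symmetry of the power, the trace of its square is its squared Frobenius
    norm.\<close>
  have "(\<Sum>e\<leftarrow>es. e ^ (k + k)) = mat_trace (A ^\<^sub>m k * A ^\<^sub>m k)"
    using mat_trace_pow[OF A es, of "k + k"] pow_mat_add[OF A, of k k] by simp
  also have "\<dots> = (\<Sum>i<n. \<Sum>j<n. (a i j)\<^sup>2)"
    using Ak symmetric_mat_index[OF Ak symmetric_pow_mat[OF A sym]]
    by (auto simp: mat_trace_def mat_mult_index_sum[OF Ak Ak] a_def power2_eq_square
        simp del: index_mult_mat(1) intro!: sum.cong)
  finally have tr: "(\<Sum>e\<leftarrow>es. e ^ (k + k)) = (\<Sum>i<n. \<Sum>j<n. (a i j)\<^sup>2)" .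
  have frob: "(\<Sum>i<n. \<Sum>j<n. (a i j - c)\<^sup>2) = (\<Sum>e\<leftarrow>es. e ^ (k + k)) - d ^ (k + k)"
  proof -
    have "(\<Sum>j<n. (a i j - c)\<^sup>2) = (\<Sum>j<n. (a i j)\<^sup>2) - d ^ (k + k) / n" if "i < n" for i
    proof -
      have "(\<Sum>j<n. (a i j - c)\<^sup>2) = (\<Sum>j<n. (a i j)\<^sup>2 - 2 * c * a i j + c\<^sup>2)"
        by (intro sum.cong refl) (simp add: power2_eq_square algebra_simps)
      also have "\<dots> = (\<Sum>j<n. (a i j)\<^sup>2) - 2 * c * (\<Sum>j<n. a i j) + n * c\<^sup>2"
        by (simp add: sum.distrib sum_subtractf sum_distrib_left)
      finally show ?thesis using False row[OF that]
        by (simp add: c_def power2_eq_square power_add field_simps)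
    qed
    then show ?thesis using False by (simp add: tr sum_subtractf)
  qed
  \<comment> \<open>Shifting the entries by \<open>c\<close> changes nothing because
    \<open>x\<close> sums to zero; then Cauchy-Schwarz row by row.\<close>
  have "(\<Sum>j<n. a i j * x j)\<^sup>2 \<le> (\<Sum>j<n. (a i j - c)\<^sup>2) * (\<Sum>j<n. (x j)\<^sup>2)" for i
  proof -
    have "(\<Sum>j<n. a i j * x j) = (\<Sum>j<n. (a i j - c) * x j) + c * (\<Sum>j<n. x j)"
      by (simp add: sum_distrib_left sum.distrib[symmetric] algebra_simps)
    then show ?thesis using x Cauchy_Schwarz_ineq_sum[of "\<lambda>j. a i j - c" x "{..<n}"] by simp
  qed
  then have "(\<Sum>i<n. (\<Sum>j<n. a i j * x j)\<^sup>2) \<le> (\<Sum>i<n. (\<Sum>j<n. (a i j - c)\<^sup>2) * (\<Sum>j<n. (x j)\<^sup>2))"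
    by (intro sum_mono)
  also have "\<dots> = (\<Sum>i<n. \<Sum>j<n. (a i j - c)\<^sup>2) * (\<Sum>j<n. (x j)\<^sup>2)"
    by (simp add: sum_distrib_right)
  finally show ?thesis unfolding frob by (simp add: a_def)
qed

section \<open>Norm bound on the orthogonal complement of the all-ones vector\<close>

text \<open>Successive ratios of \<open>f\<close> are nondecreasing, so \<open>f\<close> grows at
  least geometrically with its first ratio \<open>q\<close>; if \<open>q\<close> exceeded
  \<open>r\<close>, then \<open>f k\<close> would outgrow \<open>c * r ^ k\<close>, whatever
  \<open>c\<close> is.\<close>

lemma log_convex_ratio_le:
  fixes f :: "nat \<Rightarrow> real"
  assumes nonneg: "\<And>k. 0 \<le> f k" and conv: "\<And>k. (f (Suc k))\<^sup>2 \<le> f k * f (Suc (Suc k))"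
    and bound: "\<And>k. f k \<le> c * r ^ k" and r: "0 \<le> r"
  shows "f 1 \<le> r * f 0"
proof (cases "f 0 = 0")
  case True
  then show ?thesis using conv[of 0] by simp
next
  case False
  then have f0: "f 0 > 0" using nonneg[of 0] by simp
  define q where "q = f 1 / f 0"
  have q: "q \<ge> 0" using nonneg by (simp add: q_def)
  \<comment> \<open>Stated without division, the comparison of ratios survives zeros: once
    \<open>f k\<close> vanishes, so does \<open>f (Suc k)\<close>.\<close>
  have step: "q * f k \<le> f (Suc k)" for k
  proof (induction k)
    case 0
    show ?case using f0 by (simp add: q_def)
  next
    case (Suc k)
    show ?case
    proof (cases "f k = 0")
      case True
      then have "f (Suc k) = 0" using conv[of k] by simp
      then show ?thesis using nonneg by simp
    next
      case False
      then have pos: "f k > 0" using nonneg[of k] by simp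
      have "f k * (q * f (Suc k)) \<le> f (Suc k) * f (Suc k)"
        using mult_right_mono[OF Suc nonneg[of "Suc k"]] by (simp add: mult_ac)
      also have "\<dots> \<le> f k * f (Suc (Suc k))" using conv[of k] by (simp add: power2_eq_square)
      finally show ?thesis using pos by simp
    qed
  qed
  have growth: "q ^ k * f 0 \<le> f k" for k
  proof (induction k)
    case (Suc k)
    have "q ^ Suc k * f 0 = q * (q ^ k * f 0)" by simp
    also have "\<dots> \<le> q * f k" using Suc q by (rule mult_left_mono)
    also have "\<dots> \<le> f (Suc k)" by (rule step)
    finally show ?case .
  qed simp
  have "q \<le> r"
  proof (rule ccontr)
    assume "\<not> q \<le> r"
    then have qr: "q > r" by simp
    show False
    proof (cases "r = 0")
      case True
      then have "f 1 \<le> 0" using bound[of 1] by simp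
      then have "q \<le> 0" using f0 by (simp add: q_def divide_le_0_iff)
      then show False using qr True by simp
    next
      case False
      then have r0: "r > 0" using r by simp
      obtain k where k: "c / f 0 < (q / r) ^ k"
        using real_arch_pow[of "q / r" "c / f 0"] qr r0 by auto
      have "q ^ k * f 0 \<le> c * r ^ k" using growth[of k] bound[of k] by simp
      then have "(q / r) ^ k \<le> c / f 0" using r0 f0 by (simp add: power_divide field_simps)
      then show False using k by simp
    qed
  qed
  then show ?thesis using f0 by (simp add: q_def field_simps)
qed

text \<open>From \<open>\<bar>e0\<bar> \<le> d\<close> the even powers of \<open>e0\<close> are
  cancelled by those of \<open>d\<close>, so the trace bound leaves only the roots in
  \<open>es\<close>. It loses a factor \<open>length es\<close>, which does not depend on
  \<open>k\<close> and hence disappears by log-convexity.\<close>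

lemma symmetric_orthogonal_to_ones_bound:
  fixes A :: "real mat" and x :: "nat \<Rightarrow> real"
  assumes A: "A \<in> carrier_mat n n" and sym: "transpose_mat A = A"
    and d: "\<And>i. i < n \<Longrightarrow> (\<Sum>j<n. A $$ (i, j)) = d"
    and es: "char_poly A = (\<Prod>e\<leftarrow>e0 # es. [:- e, 1:])"
    and e0: "\<bar>e0\<bar> \<le> d" and lam: "\<And>e. e \<in> set es \<Longrightarrow> \<bar>e\<bar> \<le> lam"
    and x: "(\<Sum>j<n. x j) = 0"
  shows "(\<Sum>i<n. (\<Sum>j<n. A $$ (i, j) * x j)\<^sup>2) \<le> lam\<^sup>2 * (\<Sum>j<n. (x j)\<^sup>2)"
proof -
  define y where "y k i = (\<Sum>j<n. (A ^\<^sub>m k) $$ (i, j) * x j)" for k i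
  define f where "f k = (\<Sum>i<n. (y k i)\<^sup>2)" for k
  have y_Suc: "y (Suc k) i = (\<Sum>l<n. A $$ (i, l) * y k l)" if i: "i < n" for k i
  proof -
    have Ak: "A ^\<^sub>m k \<in> carrier_mat n n" using A by simp
    have "A ^\<^sub>m Suc k = A * A ^\<^sub>m k" using pow_mat_add[OF A, of 1 k] A by simp
    then have "y (Suc k) i = (\<Sum>j<n. \<Sum>l<n. A $$ (i, l) * (A ^\<^sub>m k) $$ (l, j) * x j)"
      using mat_mult_index_sum[OF A Ak i] by (simp add: y_def sum_distrib_right)
    also have "\<dots> = (\<Sum>l<n. A $$ (i, l) * y k l)"
      by (subst sum.swap) (simp add: y_def sum_distrib_left mult.assoc)
    finally show ?thesis .
  qed
  have y0: "y 0 i = x i" if "i < n" for i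
    using that A by (simp add: y_def if_distrib[of "\<lambda>z. z * _"] cong: if_cong)
  \<comment> \<open>Moving one factor \<open>A\<close> across the inner product turns the squared
    norm of \<open>y (Suc k)\<close> into the inner product of \<open>y k\<close> and
    \<open>y (Suc (Suc k))\<close>, to which Cauchy-Schwarz applies.\<close>
  have conv: "(f (Suc k))\<^sup>2 \<le> f k * f (Suc (Suc k))" for k
  proof -
    have "f (Suc k) = (\<Sum>i<n. \<Sum>l<n. A $$ (i, l) * y k l * y (Suc k) i)"
      by (simp add: f_def power2_eq_square y_Suc[of _ k] sum_distrib_right)
    also have "\<dots> = (\<Sum>l<n. \<Sum>i<n. A $$ (i, l) * y k l * y (Suc k) i)" by (rule sum.swap)
    also have "\<dots> = (\<Sum>l<n. y k l * y (Suc (Suc k)) l)"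
      by (intro sum.cong refl)
        (simp add: y_Suc[of _ "Suc k"] sum_distrib_left symmetric_mat_index[OF A sym] mult_ac)
    finally show ?thesis
      using Cauchy_Schwarz_ineq_sum[of "y k" "y (Suc (Suc k))" "{..<n}"] by (simp add: f_def)
  qed
  have "f k \<le> (length es * (\<Sum>j<n. (x j)\<^sup>2)) * (lam\<^sup>2) ^ k" for k
  proof -
    have "e0 ^ (k + k) \<le> d ^ (k + k)"
      using power_mono[OF e0 abs_ge_zero, of "k + k"] by (simp add: power_even_abs)
    moreover have "(\<Sum>e\<leftarrow>es. e ^ (k + k)) \<le> (\<Sum>e\<leftarrow>es. (lam\<^sup>2) ^ k)"
    proof (rule sum_list_mono)
      fix e assume "e \<in> set es"
      from power_mono[OF lam[OF this] abs_ge_zero, of "k + k"]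
      have "\<bar>e\<bar> ^ (k + k) \<le> lam ^ (k + k)" .
      then show "e ^ (k + k) \<le> (lam\<^sup>2) ^ k" by (simp add: power_even_abs power_mult[symmetric] mult_2)
    qed
    ultimately have "(\<Sum>e\<leftarrow>e0 # es. e ^ (k + k)) - d ^ (k + k) \<le> length es * (lam\<^sup>2) ^ k"
      by (simp add: sum_list_triv)
    then have "((\<Sum>e\<leftarrow>e0 # es. e ^ (k + k)) - d ^ (k + k)) * (\<Sum>j<n. (x j)\<^sup>2)
        \<le> length es * (lam\<^sup>2) ^ k * (\<Sum>j<n. (x j)\<^sup>2)"
      by (intro mult_right_mono sum_nonneg) auto
    then show ?thesis
      using symmetric_pow_deflated_bound[OF A sym d es x, of k] by (simp add: f_def y_def mult_ac)
  qed
  from log_convex_ratio_le[OF _ conv this] have "f 1 \<le> lam\<^sup>2 * f 0"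
    by (simp add: f_def sum_nonneg)
  then show ?thesis using y0 y_Suc[of _ 0] by (simp add: f_def)
qed

text \<open>Compare both sides of the eigenvector equation at a coordinate of largest absolute
  value.\<close>

lemma eigenvalue_le_row_sum:
  fixes A :: "real mat"
  assumes A: "A \<in> carrier_mat n n" and nonneg: "\<And>i j. i < n \<Longrightarrow> j < n \<Longrightarrow> 0 \<le> A $$ (i, j)"
    and d: "\<And>i. i < n \<Longrightarrow> (\<Sum>j<n. A $$ (i, j)) = d"
    and ev: "eigenvalue A e"
  shows "\<bar>e\<bar> \<le> d"
proof -
  obtain v where v: "v \<in> carrier_vec n" "v \<noteq> 0\<^sub>v n" "A *\<^sub>v v = e \<cdot>\<^sub>v v"
    using ev A unfolding eigenvalue_def eigenvector_def by auto
  obtain i0 where i0: "i0 < n" "v $ i0 \<noteq> 0"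
    using v by (metis carrier_vecD eq_vecI index_zero_vec(1,2))
  define m where "m = Max ((\<lambda>i. \<bar>v $ i\<bar>) ` {..<n})"
  have "m \<in> (\<lambda>i. \<bar>v $ i\<bar>) ` {..<n}" unfolding m_def using i0 by (intro Max_in) auto
  then obtain i where i: "i < n" "\<bar>v $ i\<bar> = m" by auto
  have le: "\<bar>v $ j\<bar> \<le> m" if "j < n" for j unfolding m_def using that by (intro Max_ge) auto
  have m: "m > 0" using le[OF i0(1)] i0(2) by simp
  have "(A *\<^sub>v v) $ i = (\<Sum>j<n. A $$ (i, j) * v $ j)"
    using i A v(1) by (auto simp: scalar_prod_def lessThan_atLeast0 intro!: sum.cong)
  then have "e * v $ i = (\<Sum>j<n. A $$ (i, j) * v $ j)" using v i by simp
  then have "\<bar>e\<bar> * m = \<bar>\<Sum>j<n. A $$ (i, j) * v $ j\<bar>" by (metis abs_mult i(2))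
  also have "\<dots> \<le> (\<Sum>j<n. \<bar>A $$ (i, j) * v $ j\<bar>)" by (rule sum_abs)
  also have "\<dots> \<le> (\<Sum>j<n. A $$ (i, j) * m)"
    using le nonneg i by (intro sum_mono) (auto simp: abs_mult intro!: mult_left_mono)
  also have "\<dots> = d * m" using d[OF i(1)] by (simp flip: sum_distrib_right)
  finally show ?thesis using m by simp
qed

section \<open>Discrepancy in spectral graphs\<close>

lemma sum_nth_distinct:
  assumes "distinct vs"
  shows "(\<Sum>j<length vs. f (vs ! j)) = (\<Sum>v\<in>set vs. f v)"
  using sum.reindex_bij_betw[OF bij_betw_nth[OF assms refl refl], of f] by simp

lemma card_Collect_eq_sum_of_bool:
  assumes "finite S"
  shows "real (card {y \<in> S. P y}) = (\<Sum>y\<in>S. of_bool (P y))"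
proof -
  have "{y \<in> S. P y} = S \<inter> Collect P" by auto
  then show ?thesis using assms by simp
qed

lemma out_degree_eq_card_neighbours:
  "out_degree (with_proj G) u = card {w. (u, w) \<in> parcs G}"
proof -
  have "out_arcs (with_proj G) u = Pair u ` {w. (u, w) \<in> parcs G}"
    by (force simp: out_arcs_def)
  then show ?thesis
    by (simp add: out_degree_def card_image inj_on_def)
qed

lemma ndl_graph_finite:
  assumes "ndl_graph n d lam G"
  shows "finite (pverts G)"
proof -
  interpret pair_graph G using assms by (simp add: ndl_graph_def)
  show ?thesis by (rule pair_finite_verts)
qed

lemma ndl_graph_row_sum:
  assumes G: "ndl_graph n d lam G" and u: "u \<in> pverts G"
  shows "(\<Sum>w\<in>pverts G. of_bool ((u, w) \<in> parcs G)) = real d"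
proof -
  interpret pair_graph G using G by (simp add: ndl_graph_def)
  have "{w. (u, w) \<in> parcs G} = {w \<in> pverts G. (u, w) \<in> parcs G}" using in_arcsD2 by auto
  then show ?thesis
    using G u out_degree_eq_card_neighbours[of G u]
      card_Collect_eq_sum_of_bool[of "pverts G" "\<lambda>w. (u, w) \<in> parcs G"]
    by (simp add: ndl_graph_def)
qed

lemma adj_matrix_index:
  assumes "i < length vs" "j < length vs"
  shows "adj_matrix G vs $$ (i, j) = of_bool ((vs ! i, vs ! j) \<in> parcs G)"
  using assms by (simp add: adj_matrix_def)

lemma adj_matrix_carrier: "adj_matrix G vs \<in> carrier_mat (length vs) (length vs)"
  by (simp add: adj_matrix_def)

lemma adj_matrix_symmetric:
  assumes "pair_graph G"
  shows "transpose_mat (adj_matrix G vs) = adj_matrix G vs"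
proof -
  interpret pair_graph G by fact
  show ?thesis by (rule eq_matI) (auto simp: adj_matrix_def intro: arcs_symmetric)
qed

text \<open>Passes from the multiset of eigenvalues to the list form of the norm bound. The
  discarded maximum \<open>e0\<close> is never identified with \<open>d\<close>; the row sum bound
  on its absolute value is enough.\<close>

lemma ndl_graph_spectrum:
  assumes G: "ndl_graph n d lam G" and n: "n > 0"
  obtains vs e0 es where "distinct vs" "set vs = pverts G" "length vs = n"
    "char_poly (adj_matrix G vs) = (\<Prod>e\<leftarrow>e0 # es. [:- e, 1:])"
    "\<bar>e0\<bar> \<le> d" "\<forall>e\<in>set es. \<bar>e\<bar> \<le> lam" "length es = n - 1"
proof -
  interpret pair_graph G using G by (simp add: ndl_graph_def)
  \<comment> \<open>The same choice as in \<open>adj_eigenvalues\<close>, so that the spectral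
    hypothesis concerns this very matrix.\<close>
  define vs where "vs = (SOME vs. distinct vs \<and> set vs = pverts G)"
  have "\<exists>vs. distinct vs \<and> set vs = pverts G"
    using finite_distinct_list[OF pair_finite_verts] by blast
  then have vs: "distinct vs" "set vs = pverts G"
    unfolding vs_def by (metis (mono_tags, lifting) someI_ex)+
  have len: "length vs = n" using vs G distinct_card[of vs] by (simp add: ndl_graph_def)
  let ?A = "adj_matrix G vs"
  have A: "?A \<in> carrier_mat n n" using adj_matrix_carrier[of G vs] len by simp
  have sym: "transpose_mat ?A = ?A" by (rule adj_matrix_symmetric) unfold_locales
  obtain fs where fs: "char_poly ?A = (\<Prod>e\<leftarrow>fs. [:- e, 1:])" "length fs = n"
    using symmetric_char_poly_splits[OF A symmetric_mat_index[OF A sym]] by blast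
  have eigs: "adj_eigenvalues G = mset fs"
  proof -
    have "proots (\<Prod>e\<leftarrow>fs. [:- e, 1:]) = mset fs"
    proof (induction fs)
      case (Cons e fs)
      have "(\<Prod>e\<leftarrow>fs. [:- e, 1:]) \<noteq> 0" by (auto simp: prod_list_zero_iff)
      then show ?case using Cons by (simp add: proots_mult del: mult_pCons_left)
    qed simp
    then show ?thesis using fs(1) by (simp add: adj_eigenvalues_def vs_def)
  qed
  define e0 where "e0 = Max_mset (mset fs)"
  \<comment> \<open>As \<open>n > 0\<close>, the list \<open>fs\<close> is nonempty and its maximum
    is attained. Only one occurrence is removed below, so further copies of \<open>e0\<close> stay
    in \<open>es\<close>.\<close>
  have e0: "e0 \<in> set fs" unfolding e0_def using fs(2) n Max_in[of "set fs"] by (cases fs) auto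
  obtain es where es: "mset es = mset fs - {#e0#}" by (metis ex_mset)
  have mset: "mset fs = mset (e0 # es)" using e0 es by simp
  have cp: "char_poly ?A = (\<Prod>e\<leftarrow>e0 # es. [:- e, 1:])"
    unfolding fs(1) prod_mset_prod_list[symmetric] mset_map mset ..
  have "eigenvalue ?A e0"
    using eigenvalue_root_char_poly[OF A] cp by simp
  then have "\<bar>e0\<bar> \<le> d"
  proof (rule eigenvalue_le_row_sum[OF A, rotated 2])
    show "(\<Sum>j<n. ?A $$ (i, j)) = d" if "i < n" for i
      using that len vs ndl_graph_row_sum[OF G, of "vs ! i"]
        sum_nth_distinct[OF vs(1), of "\<lambda>w. of_bool ((vs ! i, w) \<in> parcs G) :: real"]
      by (simp add: adj_matrix_index) (metis nth_mem)
  qed (simp add: adj_matrix_index len)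
  moreover have "\<bar>e\<bar> \<le> lam" if "e \<in> set es" for e
  proof -
    have "e \<in># adj_eigenvalues G - {#Max_mset (adj_eigenvalues G)#}"
      using that es by (simp add: eigs e0_def flip: set_mset_mset)
    then show ?thesis using G by (simp add: ndl_graph_def)
  qed
  moreover have "length es = n - 1" using mset fs(2) by (metis diff_Suc_1 length_Cons size_mset)
  ultimately show ?thesis using that vs len cp by blast
qed

text \<open>At least one eigenvalue remains after the largest is discarded, and \<open>lam\<close>
  bounds its absolute value.\<close>

lemma ndl_graph_lam_nonneg:
  assumes "ndl_graph n d lam G" "n \<ge> 2"
  shows "0 \<le> lam"
proof -
  obtain es where es: "\<forall>e\<in>set es. \<bar>e\<bar> \<le> lam" "length es = n - 1"
    using ndl_graph_spectrum[OF assms(1)] assms(2) by (metis less_le_trans pos2)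
  then obtain e where "e \<in> set es" using assms(2) by (cases es) auto
  then show ?thesis using es(1) by force
qed

text \<open>The norm bound is applied to the indicator of \<open>S\<close> minus its mean. By
  regularity the image of this vector at \<open>z\<close> is exactly the deviation being squared,
  and its own squared norm is \<open>s - s\<^sup>2 / n\<close>, at most \<open>s\<close>.\<close>

lemma ndl_graph_discrepancy:
  fixes lam :: real
  assumes G: "ndl_graph n d lam G" and S: "S \<subseteq> pverts G"
  shows "(\<Sum>z\<in>pverts G. (card {y \<in> S. (z, y) \<in> parcs G} - d / n * card S)\<^sup>2) \<le> lam\<^sup>2 * card S"
proof (cases "n = 0")
  case True
  then have "pverts G = {}" using G ndl_graph_finite[OF G] by (simp add: ndl_graph_def)
  then show ?thesis using S by simp
next
  case False
  then have n: "n > 0" by simp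
  interpret pair_graph G using G by (simp add: ndl_graph_def)
  obtain vs e0 es where vs: "distinct vs" "set vs = pverts G" "length vs = n"
    and cp: "char_poly (adj_matrix G vs) = (\<Prod>e\<leftarrow>e0 # es. [:- e, 1:])"
    and e0: "\<bar>e0\<bar> \<le> d" and es: "\<forall>e\<in>set es. \<bar>e\<bar> \<le> lam" and "length es = n - 1"
    by (rule ndl_graph_spectrum[OF G n])
  let ?A = "adj_matrix G vs"
  have A: "?A \<in> carrier_mat n n" using adj_matrix_carrier[of G vs] vs by simp
  have sym: "transpose_mat ?A = ?A" by (rule adj_matrix_symmetric) unfold_locales
  have to_verts: "(\<Sum>j<n. f (vs ! j)) = (\<Sum>v\<in>pverts G. f v)" for f :: "_ \<Rightarrow> real"
    using sum_nth_distinct[OF vs(1), of f] vs by simp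
  have vert: "vs ! i \<in> pverts G" if "i < n" for i using that vs nth_mem by blast
  have row: "(\<Sum>j<n. ?A $$ (i, j)) = d" if "i < n" for i
    using that vs to_verts[of "\<lambda>w. of_bool ((vs ! i, w) \<in> parcs G)"]
      ndl_graph_row_sum[OF G vert[OF that]] by (simp add: adj_matrix_index)
  define s where "s = real (card S)"
  define x where "x v = of_bool (v \<in> S) - s / n" for v
  have nV: "card (pverts G) = n" using G by (simp add: ndl_graph_def)
  have S_sum: "(\<Sum>v\<in>pverts G. of_bool (v \<in> S) * f v) = (\<Sum>v\<in>S. f v)" for f :: "_ \<Rightarrow> real"
    using S by (simp add: sum.If_cases of_bool_def if_distrib[of "\<lambda>z. z * _"] Int_absorb1 cong: if_cong)
  have "(\<Sum>j<n. x (vs ! j)) = 0"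
    unfolding to_verts[of x] using S_sum[of "\<lambda>_. 1"] False nV
    by (simp add: x_def sum_subtractf s_def)
  from symmetric_orthogonal_to_ones_bound[OF A sym row cp e0 bspec[OF es] this]
  have "(\<Sum>i<n. (\<Sum>j<n. ?A $$ (i, j) * x (vs ! j))\<^sup>2) \<le> lam\<^sup>2 * (\<Sum>v\<in>pverts G. (x v)\<^sup>2)"
    unfolding to_verts[of "\<lambda>v. (x v)\<^sup>2"] .
  also have "(\<Sum>v\<in>pverts G. (x v)\<^sup>2) = s - s\<^sup>2 / n"
  proof -
    have "(x v)\<^sup>2 = of_bool (v \<in> S) * (1 - 2 * (s / n)) + (s / n)\<^sup>2" for v
      by (auto simp: x_def power2_eq_square algebra_simps)
    then have "(\<Sum>v\<in>pverts G. (x v)\<^sup>2) = s * (1 - 2 * (s / n)) + n * (s / n)\<^sup>2"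
      using nV by (simp add: sum.distrib S_sum s_def)
    then show ?thesis using False by (simp add: power2_eq_square field_simps)
  qed
  also have "lam\<^sup>2 * (s - s\<^sup>2 / n) \<le> lam\<^sup>2 * s" by (intro mult_left_mono) auto
  also have "(\<Sum>i<n. (\<Sum>j<n. ?A $$ (i, j) * x (vs ! j))\<^sup>2)
      = (\<Sum>i<n. (card {y \<in> S. (vs ! i, y) \<in> parcs G} - d / n * s)\<^sup>2)"
  proof (intro sum.cong refl arg_cong[where f = "\<lambda>z. z\<^sup>2"])
    fix i assume "i \<in> {..<n}"
    then have i: "i < n" by simp
    have "(\<Sum>j<n. ?A $$ (i, j) * x (vs ! j))
        = (\<Sum>v\<in>pverts G. of_bool ((vs ! i, v) \<in> parcs G) * x v)"
      using i vs to_verts[of "\<lambda>v. of_bool ((vs ! i, v) \<in> parcs G) * x v"] by (simp add: adj_matrix_index)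
    also have "\<dots> = (\<Sum>v\<in>pverts G. of_bool (v \<in> S) * of_bool ((vs ! i, v) \<in> parcs G))
        - (\<Sum>v\<in>pverts G. of_bool ((vs ! i, v) \<in> parcs G)) * (s / n)"
      unfolding sum_distrib_right sum_subtractf[symmetric]
      by (intro sum.cong refl) (simp add: x_def algebra_simps)
    also have "\<dots> = card {y \<in> S. (vs ! i, y) \<in> parcs G} - d * (s / n)"
      using S finite_subset[OF S pair_finite_verts]
      unfolding S_sum ndl_graph_row_sum[OF G vert[OF i]] by (simp add: card_Collect_eq_sum_of_bool)
    finally show "(\<Sum>j<n. ?A $$ (i, j) * x (vs ! j))
        = card {y \<in> S. (vs ! i, y) \<in> parcs G} - d / n * s" by simp
  qed
  also have "\<dots> = (\<Sum>z\<in>pverts G. (card {y \<in> S. (z, y) \<in> parcs G} - d / n * s)\<^sup>2)"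
    by (rule to_verts)
  finally show ?thesis by (simp add: s_def)
qed

section \<open>Counting four-cycles with a pendant edge\<close>

text \<open>The pattern is a closed walk \<open>u, x, y, z\<close> with a pendant edge from
  \<open>u\<close> to \<open>v\<close>. Once \<open>u\<close> and its opposite vertex
  \<open>y\<close> are fixed, \<open>x\<close> and \<open>z\<close> range independently over their
  common neighbours in \<open>W\<close>, and \<open>v\<close> over the neighbours of
  \<open>u\<close> in \<open>W\<close>.\<close>

lemma H1_eq_sum_codegrees:
  assumes W: "finite W" and G: "pair_graph G"
  shows "H1 G W = (\<Sum>u\<in>W. card {v \<in> W. (u, v) \<in> parcs G} *
    (\<Sum>y\<in>W. (card {x \<in> {v \<in> W. (u, v) \<in> parcs G}. (y, x) \<in> parcs G})\<^sup>2))"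
proof -
  interpret pair_graph G by fact
  define N where "N u = {v \<in> W. (u, v) \<in> parcs G}" for u
  have adj_sym: "(a, b) \<in> parcs G \<longleftrightarrow> (b, a) \<in> parcs G" for a b by (blast intro: arcs_symmetric)
  define X where "X u y = {x \<in> N u. (y, x) \<in> parcs G}" for u y
  have fin: "finite (N u)" "finite (X u y)" for u y using W by (auto simp: N_def X_def)
  let ?T = "SIGMA u:W. N u \<times> (SIGMA y:W. X u y \<times> X u y)"
  have "bij_betw (\<lambda>(u, v, y, x, z). (x, y, z, u, v)) ?T {(x, y, z, u, v).
     x \<in> W \<and> y \<in> W \<and> z \<in> W \<and> u \<in> W \<and> v \<in> W \<and>
     (x, y) \<in> parcs G \<and> (y, z) \<in> parcs G \<and> (z, u) \<in> parcs G \<and>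
     (u, v) \<in> parcs G \<and> (u, x) \<in> parcs G}"
    by (rule bij_betw_byWitness[where f' = "\<lambda>(x, y, z, u, v). (u, v, y, x, z)"])
      (auto simp: N_def X_def adj_sym)
  from bij_betw_same_card[OF this, symmetric] have "H1 G W = card ?T" unfolding H1_def .
  also have "\<dots> = (\<Sum>u\<in>W. card (N u) * (\<Sum>y\<in>W. (card (X u y))\<^sup>2))"
    using W fin by (simp add: card_cartesian_product power2_eq_square)
  finally show ?thesis by (simp add: N_def X_def)
qed

lemma H1_estimate:
  fixes \<delta> lam :: real
  assumes W: "finite W" and G: "pair_graph G" and \<delta>: "0 \<le> \<delta>" and lam: "0 \<le> lam"
    and disc: "\<And>S. S \<subseteq> W \<Longrightarrow>
      (\<Sum>z\<in>W. (card {y \<in> S. (z, y) \<in> parcs G} - \<delta> * card S)\<^sup>2) \<le> lam\<^sup>2 * card S"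
    and deg: "\<And>u. u \<in> W \<Longrightarrow> card {v \<in> W. (u, v) \<in> parcs G} \<le> 2 * \<delta> * card W"
  shows "\<bar>real (H1 G W) - card W ^ 5 * \<delta> ^ 5\<bar>
    \<le> 23 * (lam\<^sup>2 * (card W ^ 3 * \<delta>\<^sup>2) + lam * (card W ^ 4 * \<delta> ^ 4))"
proof -
  interpret pair_graph G by fact
  define m where "m = real (card W)"
  define N where "N u = {v \<in> W. (u, v) \<in> parcs G}" for u
  define b where "b u = real (card (N u))" for u
  define c where "c u y = real (card {x \<in> N u. (y, x) \<in> parcs G})" for u y
  define e where "e u = b u - \<delta> * m" for u
  define g where "g u y = c u y - \<delta> * b u" for u y
  define M where "M = \<delta> * m"
  have m: "0 \<le> m" and M: "0 \<le> M" using \<delta> by (auto simp: m_def M_def)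
  have N: "N u \<subseteq> W" for u by (auto simp: N_def)
  have finN: "finite (N u)" for u using finite_subset[OF N W] .
  have b: "0 \<le> b u" "u \<in> W \<Longrightarrow> b u \<le> 2 * M" for u
    using deg[of u] by (auto simp: b_def N_def M_def m_def mult.assoc)
  have H: "real (H1 G W) = (\<Sum>u\<in>W. b u * (\<Sum>y\<in>W. (c u y)\<^sup>2))"
    unfolding H1_eq_sum_codegrees[OF W G] by (simp add: b_def c_def N_def)
  \<comment> \<open>Double counting: by symmetry of adjacency, \<open>x\<close> lies in
    \<open>N u\<close> for exactly \<open>b x\<close> vertices \<open>u\<close> of
    \<open>W\<close>.\<close>
  have swap: "(\<Sum>u\<in>W. \<Sum>x\<in>N u. f x) = (\<Sum>x\<in>W. b x * f x)" for f :: "_ \<Rightarrow> real"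
  proof -
    have "(\<Sum>u\<in>W. \<Sum>x\<in>N u. f x) = (\<Sum>x\<in>W. \<Sum>u | u \<in> W \<and> (u, x) \<in> parcs G. f x)"
      unfolding N_def by (rule sum.swap_restrict[OF W W])
    also have "\<dots> = (\<Sum>x\<in>W. b x * f x)"
    proof (intro sum.cong refl)
      fix x
      have "{u. u \<in> W \<and> (u, x) \<in> parcs G} = N x" by (auto simp: N_def intro: arcs_symmetric)
      then show "(\<Sum>u | u \<in> W \<and> (u, x) \<in> parcs G. f x) = b x * f x" by (simp add: b_def)
    qed
    finally show ?thesis .
  qed
  \<comment> \<open>Discrepancy for \<open>S = W\<close>, passed from squares to absolute values by
    Cauchy-Schwarz.\<close>
  have e_abs: "(\<Sum>u\<in>W. \<bar>e u\<bar>) \<le> lam * m"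
  proof (rule power2_le_imp_le)
    have "(\<Sum>u\<in>W. \<bar>e u\<bar>)\<^sup>2 \<le> (\<Sum>u\<in>W. (e u)\<^sup>2) * m"
      using Cauchy_Schwarz_ineq_sum[of "\<lambda>u. \<bar>e u\<bar>" "\<lambda>_. 1" W] by (simp add: m_def)
    also have "\<dots> \<le> (lam\<^sup>2 * m) * m"
      using disc[of W] m by (intro mult_right_mono) (simp_all add: e_def b_def N_def m_def)
    finally show "(\<Sum>u\<in>W. \<bar>e u\<bar>)\<^sup>2 \<le> (lam * m)\<^sup>2" by (simp add: power2_eq_square mult_ac)
  qed (use lam m in simp)
  have g_sq: "(\<Sum>y\<in>W. (g u y)\<^sup>2) \<le> lam\<^sup>2 * b u" for u
    using disc[OF N, of u] by (simp add: g_def c_def b_def)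
  \<comment> \<open>Summing the codegrees over \<open>y\<close> counts each \<open>x\<close> in
    \<open>N u\<close> exactly \<open>b x\<close> times, so the codegree deviations add up to degree
    deviations over \<open>N u\<close>.\<close>
  have g_sum: "(\<Sum>y\<in>W. g u y) = (\<Sum>x\<in>N u. e x)" for u
  proof -
    have "(\<Sum>y\<in>W. c u y) = (\<Sum>y\<in>W. \<Sum>x\<in>N u. of_bool ((y, x) \<in> parcs G))"
      unfolding c_def using card_Collect_eq_sum_of_bool[OF finN] by simp
    also have "\<dots> = (\<Sum>x\<in>N u. \<Sum>y\<in>W. of_bool ((y, x) \<in> parcs G))" by (rule sum.swap)
    also have "\<dots> = (\<Sum>x\<in>N u. b x)"
    proof (intro sum.cong refl)
      fix x
      have "{y \<in> W. (y, x) \<in> parcs G} = N x" by (auto simp: N_def intro: arcs_symmetric)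
      then show "(\<Sum>y\<in>W. of_bool ((y, x) \<in> parcs G)) = b x"
        using card_Collect_eq_sum_of_bool[OF W, of "\<lambda>y. (y, x) \<in> parcs G"] by (simp add: b_def)
    qed
    finally show ?thesis by (simp add: g_def e_def sum_subtractf b_def m_def mult_ac)
  qed
  \<comment> \<open>Main, cross and square terms of the expansion of \<open>c u y\<close> as
    \<open>\<delta> * b u + g u y\<close>.\<close>
  define T1 where "T1 = \<delta>\<^sup>2 * m * (\<Sum>u\<in>W. b u ^ 3)"
  define T2 where "T2 = 2 * \<delta> * (\<Sum>u\<in>W. (b u)\<^sup>2 * (\<Sum>x\<in>N u. e x))"
  define T3 where "T3 = (\<Sum>u\<in>W. b u * (\<Sum>y\<in>W. (g u y)\<^sup>2))"
  have split: "real (H1 G W) = T1 + T2 + T3"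
  proof -
    have "b u * (\<Sum>y\<in>W. (c u y)\<^sup>2) = \<delta>\<^sup>2 * m * b u ^ 3 + 2 * \<delta> * ((b u)\<^sup>2 * (\<Sum>x\<in>N u. e x))
        + b u * (\<Sum>y\<in>W. (g u y)\<^sup>2)" for u
    proof -
      have "(\<Sum>y\<in>W. (c u y)\<^sup>2) = (\<Sum>y\<in>W. (\<delta> * b u)\<^sup>2 + 2 * \<delta> * b u * g u y + (g u y)\<^sup>2)"
        by (intro sum.cong refl) (simp add: g_def power2_eq_square algebra_simps)
      also have "\<dots> = m * (\<delta> * b u)\<^sup>2 + 2 * \<delta> * b u * (\<Sum>x\<in>N u. e x) + (\<Sum>y\<in>W. (g u y)\<^sup>2)"
        by (simp add: sum.distrib m_def g_sum[symmetric] sum_distrib_left)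
      finally show ?thesis by (simp add: power2_eq_square power3_eq_cube algebra_simps)
    qed
    then show ?thesis unfolding H T1_def T2_def T3_def by (simp add: sum.distrib sum_distrib_left)
  qed
  have T1: "\<bar>T1 - m ^ 5 * \<delta> ^ 5\<bar> \<le> 7 * (lam * (m ^ 4 * \<delta> ^ 4))"
  proof -
    \<comment> \<open>Difference of cubes; \<open>b u \<le> 2 * M\<close> gives the constant
      \<open>7 = 4 + 2 + 1\<close>.\<close>
    have "\<bar>b u ^ 3 - M ^ 3\<bar> \<le> 7 * M\<^sup>2 * \<bar>e u\<bar>" if "u \<in> W" for u
    proof -
      have "b u ^ 3 - M ^ 3 = ((b u)\<^sup>2 + b u * M + M\<^sup>2) * e u"
        by (simp add: e_def M_def power2_eq_square power3_eq_cube algebra_simps)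
      moreover have "0 \<le> (b u)\<^sup>2 + b u * M + M\<^sup>2" using b M by simp
      moreover have "(b u)\<^sup>2 + b u * M + M\<^sup>2 \<le> 7 * M\<^sup>2"
        using power_mono[OF b(2)[OF that] b(1), of 2] mult_right_mono[OF b(2)[OF that] M]
        by (simp add: power2_eq_square)
      ultimately show ?thesis by (simp add: abs_mult mult_right_mono)
    qed
    then have "(\<Sum>u\<in>W. \<bar>b u ^ 3 - M ^ 3\<bar>) \<le> 7 * M\<^sup>2 * (\<Sum>u\<in>W. \<bar>e u\<bar>)"
      by (simp add: sum_distrib_left sum_mono)
    also have "\<dots> \<le> 7 * M\<^sup>2 * (lam * m)" by (rule mult_left_mono[OF e_abs]) simp
    finally have le: "\<bar>\<Sum>u\<in>W. b u ^ 3 - M ^ 3\<bar> \<le> 7 * M\<^sup>2 * (lam * m)"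
      by (rule order_trans[OF sum_abs])
    have "T1 - m ^ 5 * \<delta> ^ 5 = \<delta>\<^sup>2 * m * (\<Sum>u\<in>W. b u ^ 3 - M ^ 3)"
      by (simp add: T1_def sum_subtractf M_def flip: m_def) (simp add: algebra_simps power_numeral_reduce)
    then have "\<bar>T1 - m ^ 5 * \<delta> ^ 5\<bar> = \<delta>\<^sup>2 * m * \<bar>\<Sum>u\<in>W. b u ^ 3 - M ^ 3\<bar>"
      using m by (simp add: abs_mult)
    also have "\<dots> \<le> \<delta>\<^sup>2 * m * (7 * M\<^sup>2 * (lam * m))" using le m by (intro mult_left_mono) auto
    finally show ?thesis by (simp add: M_def algebra_simps power_numeral_reduce)
  qed
  \<comment> \<open>Two factors \<open>b u\<close> are bounded by \<open>2 * M\<close>, and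
    \<open>swap\<close> yields a third factor \<open>b x\<close>, bounded likewise; with the leading
    2 this gives \<open>16 = 2 * 2 ^ 3\<close>.\<close>
  have T2: "\<bar>T2\<bar> \<le> 16 * (lam * (m ^ 4 * \<delta> ^ 4))"
  proof -
    have "\<bar>\<Sum>u\<in>W. (b u)\<^sup>2 * (\<Sum>x\<in>N u. e x)\<bar> \<le> (\<Sum>u\<in>W. \<bar>(b u)\<^sup>2 * (\<Sum>x\<in>N u. e x)\<bar>)"
      by (rule sum_abs)
    also have "\<dots> \<le> (\<Sum>u\<in>W. (2 * M)\<^sup>2 * (\<Sum>x\<in>N u. \<bar>e x\<bar>))"
      unfolding abs_mult using power_mono[OF b(2) b(1), of _ 2] by (intro sum_mono mult_mono sum_abs) auto
    also have "\<dots> = (2 * M)\<^sup>2 * (\<Sum>x\<in>W. b x * \<bar>e x\<bar>)"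
      by (simp only: sum_distrib_left[symmetric] swap)
    also have "\<dots> \<le> (2 * M)\<^sup>2 * (\<Sum>x\<in>W. 2 * M * \<bar>e x\<bar>)"
      using b by (intro mult_left_mono sum_mono mult_right_mono) auto
    also have "\<dots> = (2 * M) ^ 3 * (\<Sum>x\<in>W. \<bar>e x\<bar>)"
      by (simp add: sum_distrib_left[symmetric] power2_eq_square power3_eq_cube)
    also have "\<dots> \<le> (2 * M) ^ 3 * (lam * m)" using e_abs M by (intro mult_left_mono) auto
    finally have "2 * \<delta> * \<bar>\<Sum>u\<in>W. (b u)\<^sup>2 * (\<Sum>x\<in>N u. e x)\<bar> \<le> 2 * \<delta> * ((2 * M) ^ 3 * (lam * m))"
      using \<delta> by (intro mult_left_mono) auto
    then show ?thesis using \<delta> by (simp add: T2_def abs_mult M_def algebra_simps power_numeral_reduce)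
  qed
  have T3: "0 \<le> T3" "T3 \<le> 4 * (lam\<^sup>2 * (m ^ 3 * \<delta>\<^sup>2))"
  proof -
    show "0 \<le> T3" unfolding T3_def using b by (intro sum_nonneg mult_nonneg_nonneg) auto
    have "T3 \<le> (\<Sum>u\<in>W. lam\<^sup>2 * (2 * M)\<^sup>2)" unfolding T3_def
    proof (rule sum_mono)
      fix u assume u: "u \<in> W"
      have "b u * (\<Sum>y\<in>W. (g u y)\<^sup>2) \<le> b u * (lam\<^sup>2 * b u)"
        using g_sq b by (intro mult_left_mono) auto
      also have "\<dots> = lam\<^sup>2 * (b u)\<^sup>2" by (simp add: power2_eq_square)
      also have "\<dots> \<le> lam\<^sup>2 * (2 * M)\<^sup>2" using b u by (intro mult_left_mono power_mono) auto
      finally show "b u * (\<Sum>y\<in>W. (g u y)\<^sup>2) \<le> lam\<^sup>2 * (2 * M)\<^sup>2" .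
    qed
    also have "\<dots> = 4 * (lam\<^sup>2 * (m ^ 3 * \<delta>\<^sup>2))"
      by (simp add: M_def algebra_simps power_numeral_reduce flip: m_def)
    finally show "T3 \<le> 4 * (lam\<^sup>2 * (m ^ 3 * \<delta>\<^sup>2))" .
  qed
  \<comment> \<open>The constant is \<open>23 = 7 + 16\<close> from \<open>T1\<close> and
    \<open>T2\<close>; nonnegativity allows the coefficient 4 of \<open>T3\<close> to be raised to
    it.\<close>
  have "0 \<le> lam\<^sup>2 * (m ^ 3 * \<delta>\<^sup>2)" using m by simp
  then have *: "\<bar>(T1 - m ^ 5 * \<delta> ^ 5) + T2 + T3\<bar>
      \<le> 23 * (lam\<^sup>2 * (m ^ 3 * \<delta>\<^sup>2)) + 23 * (lam * (m ^ 4 * \<delta> ^ 4))"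
    using T1 T2 T3 unfolding abs_le_iff by linarith
  have "\<bar>real (H1 G W) - m ^ 5 * \<delta> ^ 5\<bar> \<le> 23 * (lam\<^sup>2 * (m ^ 3 * \<delta>\<^sup>2) + lam * (m ^ 4 * \<delta> ^ 4))"
    using * by (simp add: split algebra_simps)
  then show ?thesis by (simp add: m_def)
qed

section \<open>Deletion of high-degree vertices\<close>

text \<open>A Chebyshev argument: the degree of each such vertex into \<open>U\<close> exceeds its
  expected value by at least half of that value, while the discrepancy for \<open>S = U\<close>
  limits the sum of squared deviations.\<close>

lemma ndl_graph_high_degree_vertices_few:
  assumes G: "ndl_graph n d lam G" and U: "U \<subseteq> pverts G"
  shows "card {u \<in> U. card {v \<in> U. (u, v) \<in> parcs G} > 3 / 2 * (d / n) * card U}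
    \<le> 4 * (lam * n / d / card U)\<^sup>2 * card U" (is "real (card ?B) \<le> _")
proof -
  interpret pair_graph G using G by (simp add: ndl_graph_def)
  have finU: "finite U" using finite_subset[OF U pair_finite_verts] .
  define s where "s = real (card U)"
  define \<delta> where "\<delta> = real d / real n"
  show ?thesis
  \<comment> \<open>In the degenerate cases the right-hand side is zero, by a zero factor or a
    division by zero, so \<open>?B\<close> must be shown empty: either \<open>U\<close> is empty or
    the graph has no edges.\<close>
  proof (cases "s = 0 \<or> \<delta> = 0")
    case True
    have "?B = {}"
    proof (cases "s = 0")
      case True
      then show ?thesis using finU by (simp add: s_def)
    next
      case False
      then have "U \<noteq> {}" using s_def by auto
      then have "n > 0" using U G by (auto simp: ndl_graph_def card_gt_0_iff)
      then have d: "d = 0" using \<open>s = 0 \<or> \<delta> = 0\<close> False by (simp add: \<delta>_def)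
      have "card {v \<in> U. (u, v) \<in> parcs G} = 0" if "u \<in> U" for u
      proof -
        have "(\<Sum>w\<in>pverts G. of_bool ((u, w) \<in> parcs G)) = (0::real)"
          using ndl_graph_row_sum[OF G, of u] that U d by auto
        then have "\<forall>w\<in>pverts G. (u, w) \<notin> parcs G"
          by (subst (asm) sum_nonneg_eq_0_iff) auto
        then show ?thesis using U by (auto simp: card_eq_0_iff)
      qed
      then show ?thesis using d by simp
    qed
    then show ?thesis by (simp only: card.empty) simp
  next
    case False
    moreover have "s \<ge> 0" "\<delta> \<ge> 0" by (simp_all add: s_def \<delta>_def)
    ultimately have pos: "s > 0" "\<delta> > 0" by auto
    have "card ?B * (\<delta> * s / 2)\<^sup>2 = (\<Sum>u\<in>?B. (\<delta> * s / 2)\<^sup>2)" by simp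
    also have "\<dots> \<le> (\<Sum>u\<in>?B. (card {y \<in> U. (u, y) \<in> parcs G} - \<delta> * s)\<^sup>2)"
      using pos by (intro sum_mono power_mono) (auto simp: \<delta>_def s_def)
    also have "\<dots> \<le> (\<Sum>u\<in>pverts G. (card {y \<in> U. (u, y) \<in> parcs G} - \<delta> * s)\<^sup>2)"
      using U by (intro sum_mono2) auto
    also have "\<dots> \<le> lam\<^sup>2 * s" unfolding \<delta>_def s_def by (rule ndl_graph_discrepancy[OF G U])
    finally have "card ?B * (\<delta> * s)\<^sup>2 \<le> 4 * lam\<^sup>2 * s" by (simp add: power_divide)
    then have "card ?B \<le> 4 * (lam / \<delta> / s)\<^sup>2 * s"
      using pos by (simp add: power_divide power_mult_distrib field_simps)
    then show ?thesis by (simp add: \<delta>_def s_def)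
  qed
qed

section \<open>The asymptotic statement\<close>

theorem theorem3p1:
  shows "\<exists>C::real. C > 0 \<and>
    (\<forall>(G :: nat \<Rightarrow> 'a pair_pre_digraph) (n :: nat \<Rightarrow> nat) (d :: nat \<Rightarrow> nat)
      (lam :: nat \<Rightarrow> real) (U :: nat \<Rightarrow> 'a set).
       (\<forall>k. ndl_graph (n k) (d k) (lam k) (G k)) \<and>
       (\<forall>k. U k \<subseteq> pverts (G k)) \<and>
       filterlim n at_top sequentially \<and>
       (\<lambda>k. lam k * real (n k) / real (d k)) \<in> o[sequentially](\<lambda>k. real (card (U k)))
       \<longrightarrow>
       (\<exists>(U' :: nat \<Rightarrow> 'a set) (\<epsilon> :: nat \<Rightarrow> real).
          (\<forall>k. U' k \<subseteq> U k) \<and>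
          \<epsilon> \<in> o[sequentially](\<lambda>_. 1) \<and>
          (\<forall>k. real (card (U' k)) = (1 - \<epsilon> k) * real (card (U k))) \<and>
          (\<forall>\<^sub>F k in sequentially.
             \<bar>real (H1 (G k) (U' k)) - real (card (U' k)) ^ 5 * real (d k) ^ 5 / real (n k) ^ 5\<bar>
             \<le> C * ((lam k)\<^sup>2 * (real (card (U' k)) ^ 3 * real (d k) ^ 2 / real (n k) ^ 2)
                   + lam k * (real (card (U' k)) ^ 4 * real (d k) ^ 4 / real (n k) ^ 4)))))"
proof (intro exI[of _ "23::real"] conjI allI impI, goal_cases)
  case 1
  show ?case by simp
next
  case (2 G n d lam U)
  then have G: "\<And>k. ndl_graph (n k) (d k) (lam k) (G k)" and U: "\<And>k. U k \<subseteq> pverts (G k)"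
    and n: "filterlim n at_top sequentially"
    and small: "(\<lambda>k. lam k * real (n k) / real (d k)) \<in> o(\<lambda>k. real (card (U k)))"
    by auto
  define q where "q k = lam k * n k / d k / card (U k)" for k
  define B where "B k = {u \<in> U k. card {v \<in> U k. (u, v) \<in> parcs (G k)} > 3 / 2 * (d k / n k) * card (U k)}" for k
  \<comment> \<open>The deleted proportion of \<open>U k\<close>. For empty \<open>U k\<close> the
    division yields 0 and the cardinality identity still holds.\<close>
  define \<epsilon> where "\<epsilon> k = real (card (B k)) / card (U k)" for k
  define U' where "U' k = U k - B k" for k
  have finU: "finite (U k)" for k
    by (rule finite_subset[OF U ndl_graph_finite[OF G]])
  have BU: "B k \<subseteq> U k" for k by (auto simp: B_def)
  have card_U': "real (card (U' k)) = (1 - \<epsilon> k) * card (U k)" for k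
  proof (cases "U k = {}")
    case False
    then show ?thesis
      using card_Diff_subset[OF finite_subset[OF BU finU] BU, of k] card_mono[OF finU BU, of k] finU
      by (simp add: U'_def \<epsilon>_def of_nat_diff field_simps)
  qed (simp add: U'_def)
  have q: "q \<longlonglongrightarrow> 0" unfolding q_def by (rule smalloD_tendsto[OF small])
  have \<epsilon>_le: "\<epsilon> k \<le> 4 * (q k)\<^sup>2" for k
    using ndl_graph_high_degree_vertices_few[OF G U, of k]
    by (cases "card (U k) = 0") (simp_all add: \<epsilon>_def B_def q_def divide_le_eq)
  have \<epsilon>: "\<epsilon> \<longlonglongrightarrow> 0"
  proof (rule tendsto_sandwich[OF _ _ tendsto_const])
    show "\<forall>\<^sub>F k in sequentially. \<epsilon> k \<le> 4 * (q k)\<^sup>2" by (simp add: \<epsilon>_le)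
    show "(\<lambda>k. 4 * (q k)\<^sup>2) \<longlonglongrightarrow> 0" using q by (auto intro!: tendsto_eq_intros)
  qed (simp add: \<epsilon>_def)
  \<comment> \<open>Keeping at least three quarters of \<open>U k\<close> converts the degree bound
    with \<open>3 / 2 * card (U k)\<close> into one with \<open>2 * card (U' k)\<close>. The
    condition \<open>n k \<ge> 2\<close> below ensures \<open>0 \<le> lam k\<close>.\<close>
  have "\<forall>\<^sub>F k in sequentially. \<epsilon> k < 1 / 4" using order_tendstoD(2)[OF \<epsilon>, of "1/4"] by simp
  moreover have "\<forall>\<^sub>F k in sequentially. n k \<ge> 2" using n by (simp add: filterlim_at_top)
  ultimately have ev: "\<forall>\<^sub>F k in sequentially.
             \<bar>real (H1 (G k) (U' k)) - real (card (U' k)) ^ 5 * real (d k) ^ 5 / real (n k) ^ 5\<bar>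
             \<le> 23 * ((lam k)\<^sup>2 * (real (card (U' k)) ^ 3 * real (d k) ^ 2 / real (n k) ^ 2)
                   + lam k * (real (card (U' k)) ^ 4 * real (d k) ^ 4 / real (n k) ^ 4))"
  proof eventually_elim
    case (elim k)
    let ?\<delta> = "real (d k) / real (n k)"
    have sub: "U' k \<subseteq> U k" "U' k \<subseteq> pverts (G k)" using U[of k] by (auto simp: U'_def)
    have "\<bar>real (H1 (G k) (U' k)) - card (U' k) ^ 5 * ?\<delta> ^ 5\<bar>
      \<le> 23 * ((lam k)\<^sup>2 * (card (U' k) ^ 3 * ?\<delta>\<^sup>2) + lam k * (card (U' k) ^ 4 * ?\<delta> ^ 4))"
    proof (rule H1_estimate)
      show "finite (U' k)" using finite_subset[OF sub(1) finU] .
      show "pair_graph (G k)" using G[of k] by (simp add: ndl_graph_def)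
      show "0 \<le> ?\<delta>" by simp
      show "0 \<le> lam k" using ndl_graph_lam_nonneg[OF G elim(2)] .
    next
      fix S assume S: "S \<subseteq> U' k"
      \<comment> \<open>Restricting the discrepancy sum from all vertices to \<open>U' k\<close>
        drops only nonnegative terms.\<close>
      have "(\<Sum>z\<in>U' k. (card {y \<in> S. (z, y) \<in> parcs (G k)} - ?\<delta> * card S)\<^sup>2)
        \<le> (\<Sum>z\<in>pverts (G k). (card {y \<in> S. (z, y) \<in> parcs (G k)} - ?\<delta> * card S)\<^sup>2)"
        using sub ndl_graph_finite[OF G] by (intro sum_mono2) auto
      also have "\<dots> \<le> (lam k)\<^sup>2 * card S"
        using S sub by (intro ndl_graph_discrepancy[OF G]) auto
      finally show "(\<Sum>z\<in>U' k. (card {y \<in> S. (z, y) \<in> parcs (G k)} - ?\<delta> * card S)\<^sup>2)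
        \<le> (lam k)\<^sup>2 * card S" .
    next
      fix u assume u: "u \<in> U' k"
      have "card {v \<in> U' k. (u, v) \<in> parcs (G k)} \<le> card {v \<in> U k. (u, v) \<in> parcs (G k)}"
        using sub finU by (intro card_mono) auto
      also have "real \<dots> \<le> ?\<delta> * (3 / 2 * card (U k))" using u by (auto simp: U'_def B_def)
      also have "\<dots> \<le> ?\<delta> * (2 * card (U' k))"
      proof (rule mult_left_mono)
        have "3 / 4 * real (card (U k)) \<le> (1 - \<epsilon> k) * card (U k)"
          using elim(1) by (intro mult_right_mono) auto
        then show "3 / 2 * real (card (U k)) \<le> 2 * card (U' k)" by (simp add: card_U')
      qed simp
      finally show "real (card {v \<in> U' k. (u, v) \<in> parcs (G k)}) \<le> 2 * ?\<delta> * card (U' k)"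
        by (simp add: mult_ac)
    qed
    then show ?case by (simp add: power_divide)
  qed
  have "\<epsilon> \<in> o(\<lambda>_. 1)" using \<epsilon> by (intro smalloI_tendsto) auto
  then show ?case using card_U' ev by (intro exI[of _ U'] exI[of _ \<epsilon>]) (auto simp: U'_def)
qed

end
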